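(* Let $\{\eta_k\}_{k=0}^\infty$ be a sequence of independent identically distributed real-valued random variables with $\mathbf{P}(\eta_0=0)<1$. Put $g_n(x)=\sum_{k=0}^n\eta_kx^k$ and let $M_n$ denote the number of real roots of the polynomial $g_n(x)$. Then $$\mathbf{P}\left\{\frac{M_n}{n}\underset{n\to\infty}{\longrightarrow}0\right\}=1\quad\text{and}\quad \mathbf{E}M_n=o(n),\quad n\to\infty.$$
   Context: Real roots are counted with multiplicity. On the event that $g_n$ is identically zero put $M_n=0$. *)

theory Defs
  imports "HOL-Probability.Probability" "HOL-Computational_Algebra.Computational_Algebra"
begin

definition random_poly :: "(nat \<Rightarrow> 'a \<Rightarrow> real) \<Rightarrow> nat \<Rightarrow> 'a \<Rightarrow> real poly" where
  "random_poly \<eta> n \<omega> = (\<Sum>k\<le>n. monom (\<eta> k \<omega>) k)"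

(* proots is the multiset of roots with multiplicity, and proots 0 = {#}, so the count is 0
   where the polynomial vanishes identically. *)
definition num_real_roots :: "(nat \<Rightarrow> 'a \<Rightarrow> real) \<Rightarrow> nat \<Rightarrow> 'a \<Rightarrow> nat" where
  "num_real_roots \<eta> n \<omega> = size (proots (random_poly \<eta> n \<omega>))"

end

theory Submission
  imports Defs
begin

text \<open>
  By Descartes' rule of signs, the number of positive roots of \<open>g\<^sub>n\<close> is at most the number of sign
  changes of the coefficients of \<open>g\<^sub>n(x) (1 + x + \<dots> + x\<^sup>m\<^sup>-\<^sup>1)\<close> for any fixed \<open>m\<close>, and these are, up
  to \<open>O(m)\<close> boundary terms, sums of \<open>m\<close> consecutive \<open>\<eta>\<close>s. Two neighbouring window sums share all but
  one summand each, so they can have different signs only if one of these two summands is large or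
  the sum of the common \<open>m - 1\<close> terms is small. Both events have small probability when \<open>m\<close> is large:
  unless \<open>\<eta>\<^sub>0\<close> is almost surely constant, sums of many independent copies of \<open>\<plusminus>\<eta>\<^sub>0\<close> are anticoncentrated.
  Window pairs at distance greater than \<open>m\<close> are independent, so Hoeffding's inequality and the
  Borel--Cantelli lemma bound the frequency of sign changes almost surely. Negative roots are handled
  by the same argument for \<open>g\<^sub>n(-x)\<close>. Since \<open>M\<^sub>n \<le> n\<close>, dominated convergence gives the expectations.
\<close>

section \<open>Descartes' rule of signs\<close>

text \<open>A list of length r + 1 witnesses r strict sign changes; unlike a bare count, a witness
  list can be extended entry by entry in inductions. The nonvanishing clause matters for one-element
  lists.\<close>

definition alternating :: "(nat \<Rightarrow> real) \<Rightarrow> nat list \<Rightarrow> bool" where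
  "alternating c l \<longleftrightarrow> successively (\<lambda>i j. i < j \<and> c i * c j < 0) l \<and> (\<forall>i\<in>set l. c i \<noteq> 0)"

lemma alternating_single [simp]: "alternating c [i] \<longleftrightarrow> c i \<noteq> 0"
  by (simp add: alternating_def)

lemma alternating_Cons_Cons:
  "alternating c (i # j # l) \<longleftrightarrow> i < j \<and> c i * c j < 0 \<and> alternating c (j # l)"
  by (auto simp: alternating_def)

lemma sum_pos_imp_ex_pos:
  fixes f :: "'b \<Rightarrow> real"
  assumes "sum f I > 0"
  obtains i where "i \<in> I" "f i > 0"
  using assms by (meson linorder_not_less sum_nonpos)

lemma mult_neg_if_same_signs:
  fixes a b x y :: real
  assumes "a * x > 0" "b * y > 0" "x * y < 0"
  shows "a * b < 0"
  using assms by (auto simp: zero_less_mult_iff mult_less_0_iff)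

text \<open>
  Relates the coefficients \<open>d\<close> of \<open>q\<close> to the coefficients \<open>c\<close> of \<open>(x - a) q\<close>, both twisted by \<open>s\<^sup>k\<close>, with
  \<open>b = s a\<close>. The sums of \<open>b\<^sup>k c\<^sub>k\<close> telescope, so every sign change of \<open>d\<close>, and either end of \<open>d\<close>,
  forces a term of prescribed sign in \<open>c\<close>.
\<close>

lemma alternating_linear_factor:
  fixes c d :: "nat \<Rightarrow> real"
  assumes b: "b > 0" and s: "s \<noteq> 0"
    and c0: "c 0 = - s * b * d 0"
    and cS: "\<And>k. c (Suc k) = s * (d k - b * d (Suc k))"
    and N: "\<And>k. k > N \<Longrightarrow> d k = 0"
    and l: "alternating d l" "l \<noteq> []"
  obtains l' where "alternating c l'" "length l' = Suc (length l)"
proof -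
  have tel0: "(\<Sum>k\<le>i. b ^ k * c k) = - s * b ^ Suc i * d i" for i
    by (induction i) (auto simp: c0 cS algebra_simps)
  have tel: "(\<Sum>k\<in>{i<..j}. b ^ k * c k) = s * (b ^ Suc i * d i - b ^ Suc j * d j)" if "i \<le> j" for i j
  proof -
    have "(\<Sum>k\<le>j. b ^ k * c k) = (\<Sum>k\<le>i. b ^ k * c k) + (\<Sum>k\<in>{i<..j}. b ^ k * c k)"
      using that by (subst sum.union_disjoint [symmetric]) (auto intro!: sum.cong)
    then show ?thesis unfolding tel0 by (simp add: algebra_simps)
  qed
  \<comment> \<open>Multiplied by \<open>s * d i\<close>, the telescoped sum over the indices from
    \<open>i + 1\<close> to \<open>j\<close> is positive, so one of its terms is positive.\<close>
  have step: "\<exists>k. i < k \<and> k \<le> j \<and> c k * (s * d i) > 0" if "i \<le> j" "d i \<noteq> 0" "d i * d j \<le> 0" for i j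
  proof -
    have "0 < (s * d i) * (s * (b ^ Suc i * d i - b ^ Suc j * d j))"
    proof -
      have "b ^ Suc i * (d i * d i) > 0" "b ^ Suc j * (d i * d j) \<le> 0"
        using b that by (auto simp: mult_le_0_iff zero_less_mult_iff)
      then have "0 < s * s * (b ^ Suc i * (d i * d i) - b ^ Suc j * (d i * d j))"
        using s not_real_square_gt_zero [of s] by (intro mult_pos_pos [of "s * s"]) (blast, linarith)
      then show ?thesis by (simp add: algebra_simps)
    qed
    also have "\<dots> = (\<Sum>k\<in>{i<..j}. b ^ k * (c k * (s * d i)))"
      by (subst tel [OF that(1), symmetric]) (simp add: sum_distrib_left mult_ac)
    finally obtain k where "k \<in> {i<..j}" "b ^ k * (c k * (s * d i)) > 0"
      by (rule sum_pos_imp_ex_pos)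
    then show ?thesis using b by (auto simp: zero_less_mult_iff)
  qed
  \<comment> \<open>The list is built from its right end. The sign at the head is carried along so
    that the next entry to the left can be given the opposite sign.\<close>
  have right: "\<exists>l'. alternating c l' \<and> length l' = length l \<and> l' \<noteq> [] \<and> hd l' > hd l \<and> c (hd l') * (s * d (hd l)) > 0"
    if "alternating d l" "l \<noteq> []" for l
    using that
  proof (induction l rule: induct_list012)
    case (2 i)
    \<comment> \<open>The last entry has no right neighbour; any index beyond \<open>N\<close>,
      where \<open>d\<close> vanishes, takes its place.\<close>
    then obtain k where "i < k" "c k * (s * d i) > 0"
      using step [of i "Suc (i + N)"] N by auto
    then show ?case by (intro exI [of _ "[k]"]) auto
  next
    case (3 i j l)
    then have ij: "i < j" "d i * d j < 0" "alternating d (j # l)"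
      by (auto simp: alternating_Cons_Cons)
    with 3 obtain l' where l': "alternating c l'" "length l' = length (j # l)" "l' \<noteq> []" "hd l' > j"
      "c (hd l') * (s * d j) > 0" by auto
    have "d i \<noteq> 0" using ij(2) by auto
    then obtain k where k: "i < k" "k \<le> j" "c k * (s * d i) > 0"
      using step [of i j] ij less_imp_le by metis
    have "0 < s * s" using s not_real_square_gt_zero [of s] by blast
    then have "(s * d i) * (s * d j) < 0"
      using mult_pos_neg [of "s * s" "d i * d j"] ij by (simp add: mult_ac)
    with k l' have "c k * c (hd l') < 0" by (meson mult_neg_if_same_signs)
    with k l' show ?case
      by (intro exI [of _ "k # l'"]) (cases l', auto simp: alternating_Cons_Cons)
  qed simp
  from right [OF l] obtain l' where l': "alternating c l'" "length l' = length l" "l' \<noteq> []" "hd l' > hd l"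
      "c (hd l') * (s * d (hd l)) > 0" by blast
  \<comment> \<open>The extra entry comes from the left end: the partial sum up to
    \<open>hd l\<close> has the sign opposite to \<open>s * d (hd l)\<close>, so some term at an
    index at most \<open>hd l\<close> has it too. That index lies to the left of
    \<open>hd l'\<close>.\<close>
  have "d (hd l) \<noteq> 0" using l by (auto simp: alternating_def)
  then have "0 < (s * d (hd l)) * (s * d (hd l))"
    using s not_real_square_gt_zero [of "s * d (hd l)"] by (metis mult_eq_0_iff)
  then have "0 < (s * d (hd l)) * (s * d (hd l)) * b ^ Suc (hd l)"
    using b by (rule mult_pos_pos [OF _ zero_less_power])
  also have "\<dots> = (s * d (hd l)) * (s * b ^ Suc (hd l) * d (hd l))" by (simp only: mult_ac)
  also have "\<dots> = (\<Sum>k\<le>hd l. b ^ k * (- c k * (s * d (hd l))))"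
    using tel0 [of "hd l"] by (simp add: sum_distrib_right [symmetric] sum_negf mult.assoc [symmetric])
  finally obtain k where "k \<le> hd l" "b ^ k * (- c k * (s * d (hd l))) > 0"
    by (rule sum_pos_imp_ex_pos) auto
  then have k: "k \<le> hd l" "c k * (s * d (hd l)) < 0"
    using b zero_less_mult_pos [of "b ^ k" "- c k * (s * d (hd l))"] by simp_all
  then have "- c k * (s * d (hd l)) > 0" by simp
  from mult_pos_pos [OF this l'(5)]
  have "(- c k * c (hd l')) * (s * d (hd l)) ^ 2 > 0" by (simp add: power2_eq_square mult_ac)
  then have "- c k * c (hd l') > 0" by (rule zero_less_mult_pos2) (use s \<open>d (hd l) \<noteq> 0\<close> in simp)
  then have "c k * c (hd l') < 0" by simp
  with k l' show ?thesis
    by (intro that [of "k # l'"]) (cases l', auto simp: alternating_Cons_Cons)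
qed

text \<open>The twisted coefficients are those of \<open>p (s x)\<close>, so the two values of
  \<open>s\<close> treat positive and negative roots alike. Induction on the number of roots
  counted: the leading coefficient gives a list of length one, and each linear factor split off
  lengthens the list by one.\<close>

lemma alternating_coeff_roots:
  fixes p :: "real poly" and s :: real
  assumes "p \<noteq> 0" and s: "s \<in> {1, -1}"
  obtains l where "alternating (\<lambda>k. s ^ k * coeff p k) l"
    "length l = Suc (size {#x \<in># proots p. s * x > 0#})"
proof -
  have "\<exists>l. alternating (\<lambda>k. s ^ k * coeff p k) l \<and> length l = Suc n"
    if "p \<noteq> 0" "size {#x \<in># proots p. s * x > 0#} = n" for n
    using that
  proof (induction n arbitrary: p)
    case 0
    have "s \<noteq> 0" using s by auto
    with 0(1) have "s ^ degree p * coeff p (degree p) \<noteq> 0" by simp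
    then show ?case by (intro exI [of _ "[degree p]"]) simp
  next
    case (Suc n)
    have "{#x \<in># proots p. s * x > 0#} \<noteq> {#}"
    proof
      assume "{#x \<in># proots p. s * x > 0#} = {#}"
      then have "size {#x \<in># proots p. s * x > 0#} = 0" by simp
      with Suc.prems(2) show False by linarith
    qed
    then obtain a where "a \<in># {#x \<in># proots p. s * x > 0#}"
      by (rule multiset_nonemptyE)
    then have a: "a \<in># proots p" "s * a > 0" by (simp_all only: set_mset_filter mem_Collect_eq)
    then have "poly p a = 0" using Suc.prems(1) by simp
    then obtain q where q: "p = [:-a, 1:] * q" unfolding poly_eq_0_iff_dvd by (rule dvdE)
    with Suc.prems(1) have "q \<noteq> 0" by auto
    have "proots p = add_mset a (proots q)"
      using \<open>q \<noteq> 0\<close> unfolding q by (subst proots_mult) auto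
    then have "size {#x \<in># proots q. s * x > 0#} = n"
      using Suc.prems(2) a(2) by simp
    then obtain l where l: "alternating (\<lambda>k. s ^ k * coeff q k) l" "length l = Suc n"
      using Suc.IH \<open>q \<noteq> 0\<close> by blast
    from \<open>s * a > 0\<close> obtain l' where "alternating (\<lambda>k. s ^ k * coeff p k) l'" "length l' = Suc (length l)"
    proof (rule alternating_linear_factor)
      show "s \<noteq> 0" using s by auto
      show "s ^ 0 * coeff p 0 = - s * (s * a) * (s ^ 0 * coeff q 0)"
        using s by (auto simp: q)
      show "s ^ Suc k * coeff p (Suc k) = s * (s ^ k * coeff q k - s * a * (s ^ Suc k * coeff q (Suc k)))" for k
        using s by (auto simp: q algebra_simps)
      show "s ^ k * coeff q k = 0" if "k > degree q" for k
        using that by (simp add: coeff_eq_0)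
    qed (use l in auto)
    with l show ?case by metis
  qed
  from this [OF assms(1) refl] that show ?thesis by metis
qed

lemma alternating_imp_card_weak_changes:
  assumes "alternating c l" "l \<noteq> []"
  shows "hd l \<le> last l" "length l \<le> Suc (card {k\<in>{hd l..<last l}. c k * c (Suc k) \<le> 0})"
  using assms
proof (induction l rule: induct_list012)
  case (3 i j l)
  {
    case 1 with 3 show ?case by (auto simp: alternating_Cons_Cons)
  next
    case 2
    then have ij: "i < j" "c i * c j < 0" "alternating c (j # l)" 
      by (auto simp: alternating_Cons_Cons)
    let ?S = "\<lambda>a b. {k\<in>{a..<b}. c k * c (Suc k) \<le> 0}"
    let ?n = "last (j # l)"
    have "?S i j \<noteq> {}"
    proof
      assume "?S i j = {}"
      then have *: "c k * c (Suc k) > 0" if "i \<le> k" "k < j" for k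
        using that by fastforce
      have "c i * c k > 0" if "i \<le> k" "k \<le> j" for k
        using that
      proof (induction k rule: dec_induct)
        case base
        then show ?case using ij by (auto simp: zero_less_mult_iff mult_less_0_iff)
      next
        case (step k)
        then have "c k * c (Suc k) > 0" "c i * c k > 0" using * by auto
        then show ?case by (auto simp: zero_less_mult_iff)
      qed
      from this [of j] ij show False by auto
    qed
    then have "card (?S i j) \<ge> 1" by (simp add: Suc_le_eq card_gt_0_iff)
    moreover have "?S i ?n = ?S i j \<union> ?S j ?n" "?S i j \<inter> ?S j ?n = {}"
      using ij 3(3) by auto
    then have "card (?S i ?n) = card (?S i j) + card (?S j ?n)"
      by (simp add: card_Un_disjoint)
    ultimately show ?case using 3(4) ij by auto
  }
qed auto

text \<open>Roots with \<open>s * x > 0\<close> are paid for by an alternating list. A root at 0 of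
  multiplicity r makes the first r coefficients vanish, which gives r more weak changes, all to the
  left of that list.\<close>

lemma card_roots_le_weak_changes:
  fixes p :: "real poly" and s :: real
  assumes p: "p \<noteq> 0" and s: "s \<in> {1, -1}" and deg: "degree p \<le> d"
  shows "size {#x \<in># proots p. s * x \<ge> 0#}
    \<le> card {k. k < d \<and> (s ^ k * coeff p k) * (s ^ Suc k * coeff p (Suc k)) \<le> 0}"
proof -
  define c where "c k = s ^ k * coeff p k" for k
  obtain l where l: "alternating c l" "length l = Suc (size {#x \<in># proots p. s * x > 0#})"
    using alternating_coeff_roots [OF p s] unfolding c_def by metis
  then have "l \<noteq> []" by auto
  have nz: "c (hd l) \<noteq> 0" "c (last l) \<noteq> 0" using l \<open>l \<noteq> []\<close> by (auto simp: alternating_def)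
  have "coeff p k = 0" if "k < order 0 p" for k
    using monom_1_dvd_iff [OF p, of "order 0 p"] monom_1_dvd_iff' [of "order 0 p" p] that by auto
  then have low: "c k = 0" if "k < order 0 p" for k using that by (simp add: c_def)
  with nz have hd: "order 0 p \<le> hd l" by (meson not_le)
  have "last l \<le> degree p" using nz le_degree by (auto simp: c_def)
  then have last: "last l \<le> d" using deg by simp
  let ?S = "\<lambda>a b. {k\<in>{a..<b}. c k * c (Suc k) \<le> 0}"
  have "{#x \<in># proots p. s * x \<ge> 0#} = {#x \<in># proots p. s * x > 0#} + {#x \<in># proots p. 0 = x#}"
    using s by (intro multiset_eqI) auto
  then have "size {#x \<in># proots p. s * x \<ge> 0#} = size {#x \<in># proots p. s * x > 0#} + order 0 p"
    using p by (simp add: filter_eq_replicate_mset)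
  also have "\<dots> \<le> card (?S (hd l) (last l)) + card (?S 0 (order 0 p))"
  proof -
    have "?S 0 (order 0 p) = {..<order 0 p}" using low by auto
    then have "card (?S 0 (order 0 p)) = order 0 p" by simp
    then show ?thesis
      using l alternating_imp_card_weak_changes(2) [OF l(1) \<open>l \<noteq> []\<close>] by simp
  qed
  also have "\<dots> = card (?S (hd l) (last l) \<union> ?S 0 (order 0 p))"
    using hd by (intro card_Un_disjoint [symmetric]) auto
  also have "\<dots> \<le> card (?S 0 d)"
    using hd last alternating_imp_card_weak_changes(1) [OF l(1) \<open>l \<noteq> []\<close>] by (intro card_mono) auto
  finally show ?thesis by (simp add: c_def)
qed

section \<open>Window sums as coefficients of a multiple of the polynomial\<close>

lemma coeff_random_poly: "coeff (random_poly \<eta> n \<omega>) k = (if k \<le> n then \<eta> k \<omega> else 0)"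
  by (simp add: random_poly_def coeff_sum)

lemma degree_random_poly_le: "degree (random_poly \<eta> n \<omega>) \<le> n"
  by (rule degree_le) (simp add: coeff_random_poly)

text \<open>After substituting \<open>s x\<close> for \<open>x\<close> the second factor becomes
  \<open>1 + x + ... + x^(m-1)\<close>, because \<open>s * s = 1\<close>. Truncated subtraction
  shortens the windows at the low end.\<close>

lemma coeff_mult_window:
  fixes p :: "real poly" and s :: real
  assumes s: "s \<in> {1, -1}"
  shows "s ^ k * coeff (p * (\<Sum>i<m. monom (s ^ i) i)) k = (\<Sum>j\<in>{Suc k - m..k}. s ^ j * coeff p j)"
proof -
  have ss: "s ^ i * s ^ i = 1" for i
  proof -
    have "s * s = 1" using s by (elim insertE) simp_all
    then show ?thesis unfolding power_mult_distrib [symmetric] by simp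
  qed
  have "s ^ k * coeff (p * (\<Sum>i<m. monom (s ^ i) i)) k
    = s ^ k * (\<Sum>j\<le>k. coeff p j * (if k - j < m then s ^ (k - j) else 0))"
    by (simp add: coeff_mult coeff_sum)
  also have "\<dots> = (\<Sum>j\<le>k. if k - j < m then s ^ j * coeff p j else 0)"
    unfolding sum_distrib_left
  proof (rule sum.cong [OF refl])
    fix j assume "j \<in> {..k}"
    then have "s ^ k = s ^ j * s ^ (k - j)" by (simp flip: power_add)
    then have "s ^ k * s ^ (k - j) = s ^ j" using ss [of "k - j"] by (simp add: mult.assoc)
    then show "s ^ k * (coeff p j * (if k - j < m then s ^ (k - j) else 0))
      = (if k - j < m then s ^ j * coeff p j else 0)"
      by (simp add: mult_ac)
  qed
  also have "\<dots> = (\<Sum>j\<in>{Suc k - m..k}. s ^ j * coeff p j)"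
    by (intro sum.mono_neutral_cong_right) auto
  finally show ?thesis .
qed

text \<open>A nonzero factor can only add roots, so the bound for the product applies. For
  \<open>m <= k < n\<close> the windows ending at \<open>k\<close> and \<open>Suc k\<close> are
  complete and stay within degree \<open>n\<close>, hence are shifted copies of \<open>W\<close>,
  which does not depend on \<open>n\<close>. The \<open>m\<close> lowest and \<open>m\<close>
  highest positions are all counted as changes.\<close>

lemma size_roots_le_window_changes:
  fixes \<eta> :: "nat \<Rightarrow> 'a \<Rightarrow> real" and \<omega> :: 'a and s :: real
  assumes s: "s \<in> {1, -1}" and m: "m > 0"
  defines "W \<equiv> \<lambda>k. \<Sum>j\<in>{Suc k..k + m}. s ^ j * \<eta> j \<omega>"
  shows "size {#x \<in># proots (random_poly \<eta> n \<omega>). s * x \<ge> 0#}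
    \<le> 2 * m + card {k. k < n \<and> W k * W (Suc k) \<le> 0}"
proof (cases "random_poly \<eta> n \<omega> = 0")
  case False
  define p where "p = random_poly \<eta> n \<omega>"
  define q where "q = (\<Sum>i<m. monom (s ^ i) i)"
  define Z where "Z k = (\<Sum>j\<in>{Suc k - m..k}. s ^ j * coeff p j)" for k
  have "coeff q 0 = 1" using m by (simp add: q_def coeff_sum)
  then have "q \<noteq> 0" by auto
  have "p \<noteq> 0" using False by (simp add: p_def)
  have "degree (p * q) \<le> n + m"
  proof -
    have "degree q \<le> m" unfolding q_def
      by (intro degree_sum_le) (auto intro: order_trans [OF degree_monom_le])
    then show ?thesis
      using degree_mult_le [of p q] degree_random_poly_le [of \<eta> n \<omega>] by (simp add: p_def)
  qed
  then have "size {#x \<in># proots (p * q). s * x \<ge> 0#} \<le> card {k. k < n + m \<and> Z k * Z (Suc k) \<le> 0}"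
    using card_roots_le_weak_changes [of "p * q" s] s \<open>p \<noteq> 0\<close> \<open>q \<noteq> 0\<close>
    unfolding q_def coeff_mult_window [OF s] Z_def by simp
  also have "{k. k < n + m \<and> Z k * Z (Suc k) \<le> 0}
    \<subseteq> {..<m} \<union> {n..<n + m} \<union> (\<lambda>k. k + m) ` {k. k < n \<and> W k * W (Suc k) \<le> 0}"
  proof
    fix k assume k: "k \<in> {k. k < n + m \<and> Z k * Z (Suc k) \<le> 0}"
    have Z: "Z i = W (i - m)" if "m \<le> i" "i \<le> n" for i
      using that unfolding Z_def W_def
      by (intro sum.cong) (auto simp: p_def coeff_random_poly)
    show "k \<in> {..<m} \<union> {n..<n + m} \<union> (\<lambda>k. k + m) ` {k. k < n \<and> W k * W (Suc k) \<le> 0}"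
    proof (cases "m \<le> k \<and> k < n")
      case True
      then have "W (k - m) * W (Suc (k - m)) \<le> 0" 
        using k Z [of k] Z [of "Suc k"] by (simp add: Suc_diff_le)
      then show ?thesis using True by (intro UnI2 image_eqI [of _ _ "k - m"]) auto
    qed (use k in auto)
  qed
  then have "card {k. k < n + m \<and> Z k * Z (Suc k) \<le> 0}
    \<le> card ({..<m} \<union> {n..<n + m} \<union> (\<lambda>k. k + m) ` {k. k < n \<and> W k * W (Suc k) \<le> 0})"
    by (intro card_mono) auto
  also have "\<dots> \<le> card {..<m} + card {n..<n + m} + card ((\<lambda>k. k + m) ` {k. k < n \<and> W k * W (Suc k) \<le> 0})"
    by (meson add_mono card_Un_le le_refl order_trans)
  also have "\<dots> = 2 * m + card {k. k < n \<and> W k * W (Suc k) \<le> 0}"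
    by (simp add: card_image)
  finally have "size {#x \<in># proots (p * q). s * x \<ge> 0#} \<le> \<dots>" .
  moreover have "size {#x \<in># proots p. s * x \<ge> 0#} \<le> size {#x \<in># proots (p * q). s * x \<ge> 0#}"
    using \<open>p \<noteq> 0\<close> \<open>q \<noteq> 0\<close> by (simp add: proots_mult)
  ultimately show ?thesis unfolding p_def by linarith
qed simp

lemma num_real_roots_le_window_changes:
  fixes \<eta> :: "nat \<Rightarrow> 'a \<Rightarrow> real" and \<omega> :: 'a
  assumes m: "m > 0"
  defines "W \<equiv> \<lambda>s k. \<Sum>j\<in>{Suc k..k + m}. s ^ j * \<eta> j \<omega>"
  shows "num_real_roots \<eta> n \<omega> \<le> 4 * m + (\<Sum>s\<in>{1, -1}. card {k. k < n \<and> W s k * W s (Suc k) \<le> 0})"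
proof -
  let ?p = "random_poly \<eta> n \<omega>"
  \<comment> \<open>A root at zero is counted on both sides, which only enlarges the bound.\<close>
  have "proots ?p \<subseteq># {#x \<in># proots ?p. 1 * x \<ge> 0#} + {#x \<in># proots ?p. - 1 * x \<ge> 0#}"
    by (intro mset_subset_eqI) (auto simp: not_le)
  then have "num_real_roots \<eta> n \<omega>
    \<le> size {#x \<in># proots ?p. 1 * x \<ge> 0#} + size {#x \<in># proots ?p. - 1 * x \<ge> 0#}"
    unfolding num_real_roots_def by (metis size_mset_mono size_union)
  then show ?thesis
    using size_roots_le_window_changes [of 1 m \<eta> n \<omega>] size_roots_le_window_changes [of "-1" m \<eta> n \<omega>] m
    unfolding W_def by simp
qed

section \<open>Measurability of the number of real roots\<close>

text \<open>The lower bound \<open>l\<close> is general so that in the induction it can be the right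
  end of the interval just placed.\<close>

lemma separate_by_rational_intervals:
  fixes xs :: "real list" and l :: real
  assumes "sorted_wrt (<) xs" "\<forall>x\<in>set xs. l < x"
  shows "\<exists>Is :: (rat \<times> rat) list. length Is = length xs
    \<and> sorted_wrt (\<lambda>I J. snd I < fst J) Is
    \<and> (\<forall>I\<in>set Is. l < of_rat (fst I) \<and> fst I < snd I)
    \<and> (\<forall>I\<in>set Is. \<exists>x\<in>set xs. of_rat (fst I) \<le> x \<and> x \<le> of_rat (snd I))"
  using assms
proof (induction xs arbitrary: l)
  case (Cons x xs)
  \<comment> \<open>\<open>x + 1\<close> only serves to bound \<open>u\<close> when no further point
    follows.\<close>
  define u where "u = Min (insert (x + 1) (set xs))"
  have "x < u" and u: "\<forall>y\<in>set xs. u \<le> y"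
    using Cons.prems by (auto simp: u_def)
  obtain a where a: "l < of_rat a" "of_rat a < x"
    using of_rat_dense [of l x] Cons.prems by auto
  obtain b where b: "x < of_rat b" "of_rat b < u"
    using of_rat_dense [OF \<open>x < u\<close>] by auto
  have "\<forall>y\<in>set xs. of_rat b < y" using b u by auto
  then obtain Is :: "(rat \<times> rat) list" where Is: "length Is = length xs"
    "sorted_wrt (\<lambda>I J. snd I < fst J) Is"
    "\<forall>I\<in>set Is. of_rat b < (of_rat (fst I) :: real) \<and> fst I < snd I"
    "\<forall>I\<in>set Is. \<exists>x\<in>set xs. of_rat (fst I) \<le> x \<and> x \<le> of_rat (snd I)"
    using Cons.IH [of "of_rat b"] Cons.prems(1) by auto
  have "l < of_rat b" using a b by linarith
  moreover have "a < b" using a b by (meson less_trans of_rat_less)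
  moreover have "b < fst I" "l < of_rat (fst I)" if "I \<in> set Is" for I
    using Is(3) that \<open>l < of_rat b\<close> by (auto simp: of_rat_less intro: less_trans)
  moreover have "\<exists>x\<in>set (x # xs). of_rat (fst I) \<le> x \<and> x \<le> of_rat (snd I)" if "I \<in> set ((a, b) # Is)" for I
  proof (cases "I = (a, b)")
    case True
    then show ?thesis using a b by (intro bexI [of _ x]) auto
  next
    case False
    then show ?thesis using that Is(4) by auto
  qed
  ultimately show ?case using Is(1,2,3) a(1)
    by (intro exI [of _ "(a, b) # Is"]) simp
qed auto

text \<open>Turns a lower bound on a cardinality into a quantifier over the countable set of lists
  of rational pairs, as measurability requires. Disjointness of the intervals makes the chosen
  points distinct.\<close>

lemma card_ge_iff_rational_intervals:
  fixes Z :: "real set"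
  assumes "finite Z"
  shows "card Z \<ge> m \<longleftrightarrow> (\<exists>Is :: (rat \<times> rat) list. length Is = m
    \<and> sorted_wrt (\<lambda>I J. snd I < fst J) Is 
    \<and> (\<forall>I\<in>set Is. fst I < snd I \<and> (\<exists>x. x \<in> Z \<and> of_rat (fst I) \<le> x \<and> x \<le> of_rat (snd I))))"
    (is "?L \<longleftrightarrow> ?R")
proof
  assume ?L
  then obtain Y where Y: "Y \<subseteq> Z" "card Y = m" "finite Y"
    using assms by (meson obtain_subset_with_card_n)
  define xs where "xs = sorted_list_of_set Y"
  have xs: "sorted_wrt (<) xs" "set xs = Y" "length xs = m"
    using Y by (auto simp: xs_def)
  \<comment> \<open>Any number below all points will do; 0 is inserted so that \<open>Min\<close> is
    taken over a nonempty set.\<close>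
  have "\<forall>x\<in>set xs. Min (insert 0 (set xs)) - 1 < x"
  proof
    fix x assume "x \<in> set xs"
    then have "Min (insert 0 (set xs)) \<le> x" by (intro Min_le) auto
    then show "Min (insert 0 (set xs)) - 1 < x" by linarith
  qed
  from separate_by_rational_intervals [OF xs(1) this] show ?R
    using xs Y(1) by blast
next
  assume ?R
  then obtain Is :: "(rat \<times> rat) list" where Is: "length Is = m"
    "sorted_wrt (\<lambda>I J. snd I < fst J) Is" "\<forall>I\<in>set Is. fst I < snd I"
    "\<forall>I\<in>set Is. \<exists>x\<in>Z. of_rat (fst I) \<le> x \<and> x \<le> of_rat (snd I)" by blast
  then obtain f where f: "\<And>I. I \<in> set Is \<Longrightarrow> f I \<in> Z \<and> of_rat (fst I) \<le> f I \<and> f I \<le> of_rat (snd I)"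
    by metis
  have "sorted_wrt (<) (map f Is)"
    unfolding sorted_wrt_map
  proof (rule sorted_wrt_mono_rel [OF _ Is(2)])
    fix I J assume "I \<in> set Is" "J \<in> set Is" "snd I < fst J"
    then show "f I < f J" using f [of I] f [of J]
      by (meson le_less_trans less_le_trans of_rat_less)
  qed
  then have "distinct (map f Is)" by (simp add: strict_sorted_iff)
  then have "card (f ` set Is) = m" using Is(1) distinct_card by fastforce
  moreover have "f ` set Is \<subseteq> Z" using f by auto
  ultimately show ?L using card_mono [OF assms] by metis
qed

text \<open>On the compact interval the minimum of \<open>\<bar>f x\<bar>\<close> is attained, so it
  is 0 as soon as arbitrarily small values occur. Conversely, continuity produces small values at
  rational points near a zero.\<close>

lemma ex_zero_iff_rational:
  fixes f :: "real \<Rightarrow> real"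
  assumes f: "continuous_on UNIV f" and ab: "a < b"
  shows "(\<exists>x. f x = 0 \<and> of_rat a \<le> x \<and> x \<le> of_rat b)
    \<longleftrightarrow> (\<forall>n::nat. \<exists>q::rat. a \<le> q \<and> q \<le> b \<and> \<bar>f (of_rat q)\<bar> < 1 / Suc n)" (is "?L \<longleftrightarrow> ?R")
proof
  assume ?L
  then obtain x where x: "f x = 0" "x \<in> {of_rat a..of_rat b}" by auto
  show ?R
  proof
    fix n :: nat
    have "isCont f x" using f by (simp add: continuous_on_eq_continuous_at)
    then have "\<exists>d>0. \<forall>y. dist y x < d \<longrightarrow> dist (f y) (f x) < 1 / Suc n"
      unfolding continuous_at_eps_delta by (metis of_nat_0_less_iff zero_less_Suc zero_less_divide_1_iff)
    then obtain d where d: "d > 0" "\<And>y. dist y x < d \<Longrightarrow> \<bar>f y\<bar> < 1 / Suc n"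
      using x by (auto simp: dist_real_def)
    have ab': "(of_rat a :: real) < of_rat b" using ab by (simp add: of_rat_less)
    \<comment> \<open>Since \<open>a < b\<close>, this interval is nonempty even if the zero is an
      endpoint.\<close>
    have "max (of_rat a) (x - d) < min (of_rat b) (x + d)"
      using x d(1) ab' by auto
    then obtain q :: rat where "max (of_rat a) (x - d) < of_rat q" "of_rat q < min (of_rat b) (x + d)"
      using of_rat_dense by blast
    then have "a \<le> q" "q \<le> b" "dist (of_rat q) x < d"
      by (auto simp: of_rat_less dist_real_def)
    with d show "\<exists>q::rat. a \<le> q \<and> q \<le> b \<and> \<bar>f (of_rat q)\<bar> < 1 / Suc n" by blast
  qed
next
  assume R: ?R
  have "compact {of_rat a..of_rat b :: real}" "{of_rat a..of_rat b :: real} \<noteq> {}"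
    using ab by (auto simp: of_rat_less_eq)
  moreover have "continuous_on {of_rat a..of_rat b} (\<lambda>x. \<bar>f x\<bar>)"
    using f by (intro continuous_intros) (auto intro: continuous_on_subset)
  ultimately obtain x where x: "x \<in> {of_rat a..of_rat b}" "\<And>y. y \<in> {of_rat a..of_rat b} \<Longrightarrow> \<bar>f x\<bar> \<le> \<bar>f y\<bar>"
    using continuous_attains_inf by metis
  have "\<bar>f x\<bar> < 1 / Suc n" for n
  proof -
    from R obtain q :: rat where "a \<le> q" "q \<le> b" "\<bar>f (of_rat q)\<bar> < 1 / Suc n" by blast
    then show ?thesis using x(2) [of "of_rat q"] by (auto simp: of_rat_less_eq)
  qed
  then have "f x = 0"
    by (metis abs_le_zero_iff linorder_not_le nat_approx_posE not_less_iff_gr_or_eq)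
  with x show ?L by auto
qed

lemma measurable_card_zeros:
  fixes F :: "'a \<Rightarrow> real \<Rightarrow> real"
  assumes F [measurable]: "\<And>x. (\<lambda>w. F w x) \<in> borel_measurable M"
    and cont: "\<And>w. continuous_on UNIV (F w)"
    and fin: "\<And>w. w \<in> space M \<Longrightarrow> finite {x. F w x = 0}"
  shows "(\<lambda>w. card {x. F w x = 0}) \<in> measurable M (count_space UNIV)"
proof -
  have "{w \<in> space M. card {x. F w x = 0} \<ge> m} \<in> sets M" for m
  proof -
    have "{w \<in> space M. card {x. F w x = 0} \<ge> m} =
      {w \<in> space M. \<exists>Is :: (rat \<times> rat) list. length Is = m
        \<and> sorted_wrt (\<lambda>I J. snd I < fst J) Is 
        \<and> (\<forall>I\<in>set Is. fst I < snd I
          \<and> (\<forall>n::nat. \<exists>q::rat. fst I \<le> q \<and> q \<le> snd I \<and> \<bar>F w (of_rat q)\<bar> < 1 / Suc n))}"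
    proof (intro Collect_cong conj_cong refl)
      fix w assume "w \<in> space M"
      then have "card {x. F w x = 0} \<ge> m \<longleftrightarrow> (\<exists>Is :: (rat \<times> rat) list. length Is = m
        \<and> sorted_wrt (\<lambda>I J. snd I < fst J) Is
        \<and> (\<forall>I\<in>set Is. fst I < snd I \<and> (\<exists>x. F w x = 0 \<and> of_rat (fst I) \<le> x \<and> x \<le> of_rat (snd I))))"
        by (subst card_ge_iff_rational_intervals [OF fin]) auto
      also have "\<dots> \<longleftrightarrow> (\<exists>Is :: (rat \<times> rat) list. length Is = m
        \<and> sorted_wrt (\<lambda>I J. snd I < fst J) Is
        \<and> (\<forall>I\<in>set Is. fst I < snd I
          \<and> (\<forall>n::nat. \<exists>q::rat. fst I \<le> q \<and> q \<le> snd I \<and> \<bar>F w (of_rat q)\<bar> < 1 / Suc n)))"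
        by (intro ex_cong1 ball_cong conj_cong refl ex_zero_iff_rational [OF cont])
      finally show "card {x. F w x = 0} \<ge> m \<longleftrightarrow> (\<exists>Is :: (rat \<times> rat) list. length Is = m
        \<and> sorted_wrt (\<lambda>I J. snd I < fst J) Is
        \<and> (\<forall>I\<in>set Is. fst I < snd I
          \<and> (\<forall>n::nat. \<exists>q::rat. fst I \<le> q \<and> q \<le> snd I \<and> \<bar>F w (of_rat q)\<bar> < 1 / Suc n)))" .
    qed
    also have "\<dots> \<in> sets M" by measurable
    finally show ?thesis .
  qed
  then have "{w \<in> space M. card {x. F w x = 0} \<ge> m} - {w \<in> space M. card {x. F w x = 0} \<ge> Suc m} \<in> sets M" for m
    by blast
  also have "{w \<in> space M. card {x. F w x = 0} \<ge> m} - {w \<in> space M. card {x. F w x = 0} \<ge> Suc m}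
    = (\<lambda>w. card {x. F w x = 0}) -` {m} \<inter> space M" for m
    by auto
  finally show ?thesis by (simp add: measurable_count_space_eq2_countable)
qed

section \<open>Multiplicities through iterated derivatives\<close>

text \<open>Over the reals, differentiation lowers the order of a root by exactly one.\<close>

lemma le_order_iff_pderiv:
  fixes p :: "real poly"
  assumes "p \<noteq> 0"
  shows "j \<le> order x p \<longleftrightarrow> (\<forall>i<j. poly ((pderiv ^^ i) p) x = 0)"
  using assms
proof (induction j arbitrary: p)
  case (Suc j)
  show ?case
  proof (cases "poly p x = 0 \<and> pderiv p \<noteq> 0")
    case True
    then have "order x p = Suc (order x (pderiv p))"
      using Suc.prems by (metis order_pderiv order_root)
    then have "Suc j \<le> order x p \<longleftrightarrow> (\<forall>i<j. poly ((pderiv ^^ i) (pderiv p)) x = 0)"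
      using Suc.IH [of "pderiv p"] True by simp
    also have "\<dots> \<longleftrightarrow> (\<forall>i<Suc j. poly ((pderiv ^^ i) p) x = 0)"
      using True by (simp add: All_less_Suc2 funpow_Suc_right del: funpow.simps)
    finally show ?thesis .
  next
    case False
    \<comment> \<open>If the derivative is zero, \<open>p\<close> is a nonzero constant and has no
      root either.\<close>
    then have "poly p x \<noteq> 0" using Suc.prems
      by (auto simp: pderiv_eq_0_iff elim!: degree_eq_zeroE)
    then show ?thesis by (auto simp: order_0I)
  qed
qed auto

text \<open>A root of order r is counted once for each \<open>j\<close> from 1 to r. The roots of
  order at least \<open>j\<close> are the zeros of one continuous function, the sum of the absolute
  values of the first \<open>j\<close> derivatives (starting with \<open>p\<close>), so
  \<open>measurable_card_zeros\<close> applies to each summand.\<close>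

lemma size_proots_conv_sum_card:
  fixes p :: "real poly"
  assumes p: "p \<noteq> 0" and deg: "degree p \<le> n"
  shows "size (proots p) = (\<Sum>j\<in>{1..n}. card {x. (\<Sum>i<j. \<bar>poly ((pderiv ^^ i) p) x\<bar>) = 0})"
proof -
  let ?R = "{x. poly p x = 0}"
  have fin: "finite ?R" using p by (rule poly_roots_finite)
  have order: "order x p \<le> n" for x
    using order_degree [OF p] deg le_trans by blast
  have "size (proots p) = (\<Sum>x\<in>?R. order x p)"
    using p by (simp add: size_multiset_overloaded_eq)
  also have "\<dots> = (\<Sum>x\<in>?R. \<Sum>j\<in>{1..n}. if j \<le> order x p then 1 else 0)"
  proof (intro sum.cong refl)
    fix x
    have "{1..n} \<inter> {j. j \<le> order x p} = {1..order x p}" using order [of x] by auto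
    then show "order x p = (\<Sum>j\<in>{1..n}. if j \<le> order x p then 1 else 0)"
      by (simp add: sum.If_cases)
  qed
  also have "\<dots> = (\<Sum>j\<in>{1..n}. card {x\<in>?R. j \<le> order x p})"
    using fin by (subst sum.swap) (simp add: sum.If_cases Collect_conj_eq)
  also have "\<dots> = (\<Sum>j\<in>{1..n}. card {x. (\<Sum>i<j. \<bar>poly ((pderiv ^^ i) p) x\<bar>) = 0})"
  proof (intro sum.cong refl arg_cong [of _ _ card] Collect_cong)
    fix j x assume "j \<in> {1..n}"
    then have "(x \<in> ?R \<and> j \<le> order x p) \<longleftrightarrow> j \<le> order x p"
      using order_root [of p x] by auto
    also have "\<dots> \<longleftrightarrow> (\<forall>i<j. poly ((pderiv ^^ i) p) x = 0)"
      using p by (rule le_order_iff_pderiv)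
    also have "\<dots> \<longleftrightarrow> (\<Sum>i<j. \<bar>poly ((pderiv ^^ i) p) x\<bar>) = 0"
      by (subst sum_nonneg_eq_0_iff) auto
    finally show "(x \<in> ?R \<and> j \<le> order x p) \<longleftrightarrow> (\<Sum>i<j. \<bar>poly ((pderiv ^^ i) p) x\<bar>) = 0" .
  qed
  finally show ?thesis .
qed

lemma funpow_pderiv_sum: "(pderiv ^^ i) (\<Sum>k\<in>K. f k) = (\<Sum>k\<in>K. (pderiv ^^ i) (f k))"
  by (induction K rule: infinite_finite_induct) (auto simp: higher_pderiv_add)

lemma measurable_num_real_roots:
  assumes [measurable]: "\<And>k. \<eta> k \<in> borel_measurable M"
  shows "num_real_roots \<eta> n \<in> measurable M (count_space UNIV)"
proof -
  \<comment> \<open>Zero sets are finite only where the polynomial is nonzero; off \<open>?N\<close>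
    the root count is 0 by convention.\<close>
  let ?N = "{w \<in> space M. \<exists>k\<le>n. \<eta> k w \<noteq> 0}"
  have nz: "random_poly \<eta> n w \<noteq> 0 \<longleftrightarrow> (\<exists>k\<le>n. \<eta> k w \<noteq> 0)" for w
    by (auto simp: poly_eq_iff coeff_random_poly)
  let ?F = "\<lambda>j w x. (\<Sum>i<j. \<bar>poly ((pderiv ^^ i) (random_poly \<eta> n w)) x\<bar>)"
  have meas: "(\<lambda>w. poly ((pderiv ^^ i) (random_poly \<eta> n w)) x) \<in> borel_measurable M" for i x
  proof -
    \<comment> \<open>For fixed \<open>x\<close>, each derivative is a linear combination of the
      \<open>\<eta> k\<close> with deterministic weights.\<close>
    have "poly ((pderiv ^^ i) (random_poly \<eta> n w)) x
      = (\<Sum>k\<le>n. \<eta> k w * poly ((pderiv ^^ i) (monom 1 k)) x)" for w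
    proof -
      have "monom (\<eta> k w) k = smult (\<eta> k w) (monom 1 k)" for k by (simp add: smult_monom)
      then show ?thesis
        by (simp add: random_poly_def funpow_pderiv_sum poly_sum higher_pderiv_smult)
    qed
    then show ?thesis by simp
  qed
  note [measurable] = meas
  have cont: "continuous_on UNIV (?F j w)" for j w
    by (intro continuous_intros)
  \<comment> \<open>For \<open>j = 0\<close> the empty sum would vanish everywhere.\<close>
  have card: "(\<lambda>w. card {x. ?F j w x = 0}) \<in> measurable (restrict_space M ?N) (count_space UNIV)"
    if "j \<ge> 1" for j
  proof (rule measurable_card_zeros [OF _ cont])
    show "(\<lambda>w. ?F j w x) \<in> borel_measurable (restrict_space M ?N)" for x
      by (intro measurable_restrict_space1) measurable
    fix w assume "w \<in> space (restrict_space M ?N)"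
    then have "random_poly \<eta> n w \<noteq> 0" by (auto simp: nz space_restrict_space)
    then show "finite {x. ?F j w x = 0}"
      by (rule finite_subset [rotated, OF poly_roots_finite])
        (use that in \<open>auto simp: sum_nonneg_eq_0_iff dest!: bspec [of _ _ 0]\<close>)
  qed
  have "(\<lambda>w. \<Sum>j\<in>{1..n}. card {x. ?F j w x = 0}) \<in> measurable (restrict_space M ?N) (count_space UNIV)"
    by (intro measurable_sum_nat card) auto
  then have 1: "num_real_roots \<eta> n \<in> measurable (restrict_space M ?N) (count_space UNIV)"
  proof (rule measurable_cong [THEN iffD1, rotated])
    fix w assume "w \<in> space (restrict_space M ?N)"
    then have "random_poly \<eta> n w \<noteq> 0" by (auto simp: nz space_restrict_space)
    then show "(\<Sum>j\<in>{1..n}. card {x. ?F j w x = 0}) = num_real_roots \<eta> n w"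
      unfolding num_real_roots_def using degree_random_poly_le by (intro size_proots_conv_sum_card [symmetric])
  qed
  have N: "?N \<in> sets M" by measurable
  have "(\<lambda>w. if w \<in> ?N then num_real_roots \<eta> n w else 0) \<in> measurable M (count_space UNIV)"
    by (rule measurable_If_restrict_space_iff [THEN iffD2]) (use N 1 in auto)
  also have "?this \<longleftrightarrow> ?thesis"
  proof (rule measurable_cong)
    fix w assume "w \<in> space M"
    then have "w \<notin> ?N \<Longrightarrow> random_poly \<eta> n w = 0" using nz by auto
    then show "(if w \<in> ?N then num_real_roots \<eta> n w else 0) = num_real_roots \<eta> n w"
      by (auto simp: num_real_roots_def)
  qed
  finally show ?thesis .
qed

section \<open>Anticoncentration of sums\<close>

lemma AE_iexp_neq_1:
  assumes "d \<noteq> 0"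
  shows "AE t in lborel. iexp (t * d) \<noteq> 1"
proof (rule AE_I')
  have "{t. iexp (t * d) = 1} \<subseteq> range (\<lambda>n::int. 2 * of_int n * pi / d)"
    using assms by (auto simp: exp_eq_1 field_simps)
  then have "countable {t. iexp (t * d) = 1}"
    by (rule countable_subset) auto
  then show "{t. iexp (t * d) = 1} \<in> null_sets lborel"
    by (rule countable_imp_null_set_lborel)
qed auto

text \<open>Modulus 1 at \<open>t\<close> forces \<open>iexp (t * x)\<close> to be almost surely
  constant, hence \<open>iexp (t * (x - y)) = 1\<close> for almost all pairs. For fixed
  \<open>x\<close> different from \<open>y\<close> this happens only for countably many
  \<open>t\<close>, so by Fubini almost every \<open>t\<close> excludes it for almost all such
  pairs; then the distribution would be a point mass. Lattice distributions show that single
  \<open>t\<close> must be excepted.\<close>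

lemma AE_cmod_char_less_1:
  assumes "real_distribution M" and nondeg: "\<And>c. \<not> (AE x in M. x = c)"
  shows "AE t in lborel. cmod (char M t) < 1"
proof -
  interpret real_distribution M by fact
  interpret MM: pair_prob_space M M ..
  interpret MMt: pair_sigma_finite "M \<Otimes>\<^sub>M M" lborel ..
  have "AE p in M \<Otimes>\<^sub>M M. AE t in lborel. fst p \<noteq> snd p \<longrightarrow> iexp (t * (fst p - snd p)) \<noteq> 1"
  proof (rule AE_I2)
    fix p :: "real \<times> real"
    show "AE t in lborel. fst p \<noteq> snd p \<longrightarrow> iexp (t * (fst p - snd p)) \<noteq> 1"
    proof (cases "fst p = snd p")
      case False
      then have "AE t in lborel. iexp (t * (fst p - snd p)) \<noteq> 1" by (intro AE_iexp_neq_1) simp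
      then show ?thesis by eventually_elim blast
    qed simp
  qed
  then have "AE t in lborel. AE p in M \<Otimes>\<^sub>M M. fst p \<noteq> snd p \<longrightarrow> iexp (t * (fst p - snd p)) \<noteq> 1"
    by (subst MMt.AE_commute [symmetric]) measurable
  then show ?thesis
  proof eventually_elim
    case (elim t)
    then have sep: "AE x in M. AE y in M. x \<noteq> y \<longrightarrow> iexp (t * (x - y)) \<noteq> 1"
      using MM.AE_pair [OF elim] by simp
    show ?case
    proof (rule ccontr)
      assume "\<not> cmod (char M t) < 1"
      with cmod_char_le_1 [of t] have norm1: "cmod (char M t) = 1" by simp
      define u where "u = char M t"
      have uu: "cnj u * u = 1" "u * cnj u = 1"
        using norm1 by (simp_all add: u_def complex_norm_square [symmetric] mult.commute)
      have int: "integrable M (\<lambda>x. iexp (t * x))" by (rule integrable_iexp) auto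
      \<comment> \<open>After rotation by \<open>cnj u\<close> the integrand has real part at most 1
        and mean 1, so it equals 1 almost surely.\<close>
      have "(\<integral>x. Re (cnj u * iexp (t * x)) \<partial>M) = Re (\<integral>x. cnj u * iexp (t * x) \<partial>M)"
        using int by (intro integral_Re integrable_mult_right)
      also have "\<dots> = 1"
        using int uu by (simp add: u_def char_def)
      finally have I: "(\<integral>x. Re (cnj u * iexp (t * x)) \<partial>M) = 1" .
      have int': "integrable M (\<lambda>x. Re (cnj u * iexp (t * x)))"
        using int by (intro integrable_Re integrable_mult_right)
      then have int1: "integrable M (\<lambda>x. 1 - Re (cnj u * iexp (t * x)))"
        by (intro Bochner_Integration.integrable_diff integrable_const)
      have "(\<integral>x. 1 - Re (cnj u * iexp (t * x)) \<partial>M) = measure M (space M) - 1"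
        unfolding Bochner_Integration.integral_diff [OF integrable_const int'] I by simp
      also have "\<dots> = 0" by (simp only: prob_space diff_self)
      finally have "(\<integral>x. 1 - Re (cnj u * iexp (t * x)) \<partial>M) = 0" .
      moreover have "0 \<le> 1 - Re (cnj u * iexp (t * x))" for x
        using complex_Re_le_cmod [of "cnj u * iexp (t * x)"] norm1 by (simp add: norm_mult u_def)
      ultimately have "AE x in M. 1 - Re (cnj u * iexp (t * x)) = 0"
        using integral_nonneg_eq_0_iff_AE [OF int1] by blast
      then have eq: "AE x in M. iexp (t * x) = u"
      proof eventually_elim
        case (elim x)
        have n: "cmod (cnj u * iexp (t * x)) = 1" using norm1 by (simp add: norm_mult u_def)
        with elim have "cnj u * iexp (t * x) = 1"
          by (auto simp: complex_eq_iff cmod_def)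
        then have "u * (cnj u * iexp (t * x)) = u" by simp
        then show ?case by (simp only: mult.assoc [symmetric] uu mult_1)
      qed
      from sep eq have "AE x in M. False"
      proof eventually_elim
        case (elim x)
        from elim(1) eq have "AE y in M. y = x"
        proof eventually_elim
          case (elim y)
          have "iexp (t * (x - y)) = iexp (t * x) / iexp (t * y)"
            by (simp add: exp_diff [symmetric] algebra_simps)
          also have "\<dots> = 1" using elim \<open>iexp (t * x) = u\<close> norm1 u_def by auto
          finally show ?case using elim(1) by auto
        qed
        with nondeg show ?case by blast
      qed
      then show False by simp
    qed
  qed
qed

text \<open>
  The indicator of \<open>[-1, 1]\<close> is at most a multiple of the Gaussian \<open>exp (- x\<^sup>2 / 2)\<close>, which is itself
  the characteristic function of the standard normal distribution; Fubini exchanges the roles.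
\<close>

lemma (in prob_space) prob_abs_sum_le_1:
  assumes indep: "indep_vars (\<lambda>_. borel) X I"
  shows "prob {\<omega>\<in>space M. \<bar>\<Sum>i\<in>I. X i \<omega>\<bar> \<le> 1}
    \<le> exp (1/2) * (\<integral>t. (\<Prod>i\<in>I. cmod (char (distr M borel (X i)) t)) \<partial>std_normal_distribution)"
proof -
  interpret N: real_distribution std_normal_distribution by (rule real_dist_normal_dist)
  interpret P: pair_prob_space M std_normal_distribution ..
  have [measurable]: "X i \<in> borel_measurable M" if "i \<in> I" for i
    using indep that by (auto simp: indep_vars_def)
  define S where "S \<omega> = (\<Sum>i\<in>I. X i \<omega>)" for \<omega>
  have S [measurable]: "S \<in> borel_measurable M" unfolding S_def by measurable
  let ?g = "\<lambda>\<omega>. exp (- ((S \<omega>)\<^sup>2 / 2))"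
  have intg: "integrable M ?g"
    by (rule integrable_const_bound [where B = 1]) auto
  have "prob {\<omega>\<in>space M. \<bar>S \<omega>\<bar> \<le> 1} = (\<integral>\<omega>. indicator {\<omega>\<in>space M. \<bar>S \<omega>\<bar> \<le> 1} \<omega> \<partial>M)"
    by simp
  also have "\<dots> \<le> (\<integral>\<omega>. exp (1/2) * ?g \<omega> \<partial>M)"
  proof (rule integral_mono)
    \<comment> \<open>The constant \<open>exp (1/2)\<close> is the reciprocal of the least value of
      the Gaussian on \<open>[-1, 1]\<close>.\<close>
    show "indicator {\<omega>\<in>space M. \<bar>S \<omega>\<bar> \<le> 1} \<omega> \<le> exp (1/2) * ?g \<omega>" for \<omega>
    proof (cases "\<bar>S \<omega>\<bar> \<le> 1")
      case True
      then have "(S \<omega>)\<^sup>2 \<le> 1" by (simp add: abs_square_le_1)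
      then have "1 \<le> exp (1/2 + - ((S \<omega>)\<^sup>2 / 2))" by simp
      then show ?thesis by (simp add: exp_add [symmetric] indicator_def)
    qed auto
  qed (use intg in \<open>auto intro!: integrable_real_indicator simp: emeasure_eq_measure\<close>)
  also have "\<dots> = exp (1/2) * (\<integral>\<omega>. ?g \<omega> \<partial>M)" by simp
  also have "(\<integral>\<omega>. ?g \<omega> \<partial>M) \<le> (\<integral>t. (\<Prod>i\<in>I. cmod (char (distr M borel (X i)) t)) \<partial>std_normal_distribution)"
  proof -
    have int: "integrable (M \<Otimes>\<^sub>M std_normal_distribution) (\<lambda>(\<omega>, t). iexp (S \<omega> * t))"
      by (rule P.P.integrable_const_bound [where B = 1]) (auto simp: split_beta)
    have "complex_of_real (\<integral>\<omega>. ?g \<omega> \<partial>M) = (\<integral>\<omega>. complex_of_real (?g \<omega>) \<partial>M)"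
      by simp
    also have "\<dots> = (\<integral>\<omega>. char std_normal_distribution (S \<omega>) \<partial>M)"
      by (simp add: char_std_normal_distribution)
    also have "\<dots> = (\<integral>\<omega>. (\<integral>t. iexp (S \<omega> * t) \<partial>std_normal_distribution) \<partial>M)"
      by (simp add: char_def)
    also have "\<dots> = (\<integral>t. (\<integral>\<omega>. iexp (S \<omega> * t) \<partial>M) \<partial>std_normal_distribution)"
      using int by (rule P.Fubini_integral [symmetric])
    also have "\<dots> = (\<integral>t. char (distr M borel S) t \<partial>std_normal_distribution)"
      by (simp add: char_def integral_distr mult.commute)
    also have "\<dots> = (\<integral>t. (\<Prod>i\<in>I. char (distr M borel (X i)) t) \<partial>std_normal_distribution)"
      unfolding S_def using indep by (subst char_distr_sum) auto
    finally have "(\<integral>\<omega>. ?g \<omega> \<partial>M) \<le> cmod \<dots>"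
      by (metis Re_complex_of_real complex_Re_le_cmod)
    also have "\<dots> \<le> (\<integral>t. cmod (\<Prod>i\<in>I. char (distr M borel (X i)) t) \<partial>std_normal_distribution)"
      by (rule integral_norm_bound)
    finally show ?thesis by (simp add: prod_norm)
  qed
  finally show ?thesis by (simp add: S_def)
qed

text \<open>After division by \<open>K\<close> the characteristic function bound depends on
  \<open>I\<close> only through \<open>card I\<close>, and not on the signs because
  \<open>\<phi> (- x)\<close> is the conjugate of \<open>\<phi> x\<close>. It tends to 0 by
  dominated convergence, since powers of a number of modulus below 1 vanish in the limit.\<close>

lemma (in prob_space) anticoncentration:
  fixes \<eta> :: "nat \<Rightarrow> 'a \<Rightarrow> real"
  assumes indep: "indep_vars (\<lambda>_. borel) \<eta> UNIV"
    and ident: "\<And>k. distr M borel (\<eta> k) = distr M borel (\<eta> 0)"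
    and nondeg: "\<And>c. \<not> (AE \<omega> in M. \<eta> 0 \<omega> = c)"
    and "K > 0" "\<epsilon> > 0"
  shows "\<exists>m. \<forall>I s. finite I \<and> m \<le> card I \<and> (\<forall>k. s k \<in> {1, -1}) \<longrightarrow>
    prob {\<omega>\<in>space M. \<bar>\<Sum>k\<in>I. s k * \<eta> k \<omega>\<bar> \<le> K} \<le> \<epsilon>"
proof -
  have [measurable]: "\<eta> k \<in> borel_measurable M" for k
    using indep by (auto simp: indep_vars_def)
  interpret D: real_distribution "distr M borel (\<eta> 0)" by simp
  define \<phi> where "\<phi> = char (distr M borel (\<eta> 0))"
  have [measurable]: "\<phi> \<in> borel_measurable borel" unfolding \<phi>_def by measurable
  have le1: "cmod (\<phi> t) \<le> 1" for t unfolding \<phi>_def by (rule D.cmod_char_le_1)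
  have "AE t in lborel. cmod (\<phi> t) < 1"
    unfolding \<phi>_def
  proof (rule AE_cmod_char_less_1)
    show "\<not> (AE x in distr M borel (\<eta> 0). x = c)" for c
      using nondeg [of c] by (simp add: AE_distr_iff)
  qed unfold_locales
  \<comment> \<open>Rescaling preserves null sets, and the normal distribution has a density with
    respect to \<open>lborel\<close>.\<close>
  then have "AE t in lborel. cmod (\<phi> (0 + (1 / K) * t)) < 1"
    using \<open>K > 0\<close> by (intro AE_borel_affine) auto
  then have lt1: "AE t in std_normal_distribution. cmod (\<phi> (t / K)) < 1"
    by (subst AE_density) auto
  interpret N: real_distribution std_normal_distribution by (rule real_dist_normal_dist)
  define b where "b m = exp (1/2) * (\<integral>t. cmod (\<phi> (t / K)) ^ m \<partial>std_normal_distribution)" for m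
  have "(\<lambda>m. \<integral>t. cmod (\<phi> (t / K)) ^ m \<partial>std_normal_distribution)
      \<longlonglongrightarrow> (\<integral>t. 0 \<partial>std_normal_distribution)"
  proof (rule integral_dominated_convergence [where w = "\<lambda>_. 1"])
    show "AE t in std_normal_distribution. (\<lambda>m. cmod (\<phi> (t / K)) ^ m) \<longlonglongrightarrow> 0"
      using lt1 by eventually_elim (auto intro!: LIMSEQ_realpow_zero)
    show "AE t in std_normal_distribution. norm (cmod (\<phi> (t / K)) ^ m) \<le> 1" for m
      using le1 by (auto simp: power_le_one)
  qed auto
  then have "b \<longlonglongrightarrow> 0"
    unfolding b_def by (auto intro: tendsto_mult_right_zero)
  then have "eventually (\<lambda>m. b m < \<epsilon>) sequentially"
    using \<open>\<epsilon> > 0\<close> by (rule order_tendstoD)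
  then obtain m where m: "b m < \<epsilon>" by (auto simp: eventually_sequentially)
  show ?thesis
  proof (intro exI [of _ m] allI impI)
    fix I :: "nat set" and s :: "nat \<Rightarrow> real"
    assume "finite I \<and> m \<le> card I \<and> (\<forall>k. s k \<in> {1, -1})"
    then have I: "finite I" "m \<le> card I" and s: "s k \<in> {1, -1}" for k by auto
    define X where "X k \<omega> = s k * \<eta> k \<omega> / K" for k \<omega>
    have "indep_vars (\<lambda>_. borel) X I"
      unfolding X_def
      by (rule indep_vars_compose2 [OF indep_vars_subset [OF indep]]) auto
    note small = prob_abs_sum_le_1 [OF this]
    have char: "cmod (char (distr M borel (X k)) t) = cmod (\<phi> (t / K))" for k t
    proof -
      have "char (distr M borel (X k)) t = (\<integral>\<omega>. iexp (t * X k \<omega>) \<partial>M)"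
        unfolding char_def X_def by (subst integral_distr) auto
      also have "\<dots> = (\<integral>\<omega>. iexp ((s k * t / K) * \<eta> k \<omega>) \<partial>M)"
        by (simp add: X_def mult_ac)
      also have "\<dots> = char (distr M borel (\<eta> k)) (s k * t / K)"
        unfolding char_def by (subst integral_distr) auto
      also have "\<dots> = \<phi> (s k * (t / K))" by (simp add: \<phi>_def ident [of k])
      finally have *: "char (distr M borel (X k)) t = \<phi> (s k * (t / K))" .
      have "\<phi> (- x) = cnj (\<phi> x)" for x
      proof -
        have "\<phi> (- x) = (\<integral>y. cnj (iexp (x * y)) \<partial>distr M borel (\<eta> 0))"
          unfolding \<phi>_def char_def by (intro Bochner_Integration.integral_cong refl) (simp add: exp_cnj)
        also have "\<dots> = cnj (\<phi> x)"
          unfolding \<phi>_def char_def by simp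
        finally show ?thesis .
      qed
      then show ?thesis using * s [of k] by auto
    qed
    have "prob {\<omega>\<in>space M. \<bar>\<Sum>k\<in>I. s k * \<eta> k \<omega>\<bar> \<le> K} = prob {\<omega>\<in>space M. \<bar>\<Sum>k\<in>I. X k \<omega>\<bar> \<le> 1}"
      using \<open>K > 0\<close> by (simp add: X_def field_simps flip: sum_divide_distrib)
    also have "\<dots> \<le> exp (1/2) * (\<integral>t. cmod (\<phi> (t / K)) ^ card I \<partial>std_normal_distribution)"
      using small by (simp add: char)
    also have "\<dots> \<le> b m"
      unfolding b_def
    proof (intro mult_left_mono integral_mono)
      show "cmod (\<phi> (t / K)) ^ card I \<le> cmod (\<phi> (t / K)) ^ m" for t
        using I(2) le1 by (intro power_decreasing) auto
    qed (auto intro!: N.integrable_const_bound [where B = 1] simp: power_le_one le1)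
    finally show "prob {\<omega>\<in>space M. \<bar>\<Sum>k\<in>I. s k * \<eta> k \<omega>\<bar> \<le> K} \<le> \<epsilon>"
      using m by linarith
  qed
qed

section \<open>Frequency of sign changes\<close>

text \<open>Each residue class modulo \<open>L\<close> is an independent sequence, for which
  Hoeffding's inequality gives geometrically small tails and Borel--Cantelli an almost sure bound.
  The \<open>L\<close> classes are then added up.\<close>

lemma (in prob_space) AE_eventually_sum_le:
  fixes X :: "nat \<Rightarrow> 'a \<Rightarrow> real"
  assumes indep: "\<And>r. indep_vars (\<lambda>_. borel) (\<lambda>j. X (r + j * L)) UNIV"
    and X01: "\<And>k \<omega>. X k \<omega> \<in> {0..1}"
    and p: "\<And>k. expectation (X k) \<le> p" and "L > 0" "\<epsilon> > 0"
  shows "AE \<omega> in M. eventually (\<lambda>n. (\<Sum>k<n. X k \<omega>) \<le> (p + \<epsilon>) * real (n + L)) sequentially"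
proof -
  have [measurable]: "X k \<in> borel_measurable M" for k
    using indep [of k] by (auto simp: indep_vars_def dest!: spec [of _ 0])
  let ?S = "\<lambda>r J \<omega>. (\<Sum>j<J. X (r + j * L) \<omega>)"
  let ?B = "\<lambda>r J. {\<omega>\<in>space M. ?S r J \<omega> \<ge> (p + \<epsilon>) * J}"
  have B: "prob (?B r J) \<le> exp (- (2 * \<epsilon>\<^sup>2)) ^ J" if "J > 0" for r J
  proof -
    let ?\<mu> = "\<Sum>j<J. expectation (X (r + j * L))"
    interpret H: Hoeffding_ineq M "{..<J}" "\<lambda>j. X (r + j * L)" "\<lambda>_. 0" "\<lambda>_. 1" ?\<mu>
      by unfold_locales (use X01 in \<open>auto intro: indep_vars_subset [OF indep]\<close>)
    have "?\<mu> \<le> (\<Sum>j<J. p)" using p by (rule sum_mono)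
    then have \<mu>: "?\<mu> + \<epsilon> * J \<le> (p + \<epsilon>) * J" by (simp add: algebra_simps)
    have "prob (?B r J) \<le> prob {\<omega>\<in>space M. ?S r J \<omega> \<ge> ?\<mu> + \<epsilon> * J}"
      using \<mu> by (intro finite_measure_mono) auto
    also have "\<dots> \<le> exp (- 2 * (\<epsilon> * J)\<^sup>2 / (\<Sum>j<J. (1 - 0)\<^sup>2))"
      using that \<open>\<epsilon> > 0\<close> by (intro H.Hoeffding_ineq_ge) auto
    also have "- 2 * (\<epsilon> * J)\<^sup>2 / (\<Sum>j<J. (1 - 0)\<^sup>2) = real J * (- 2 * \<epsilon>\<^sup>2)"
      using that by (simp add: power2_eq_square)
    also have "exp \<dots> = exp (- (2 * \<epsilon>\<^sup>2)) ^ J" by (simp add: exp_of_nat_mult [symmetric])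
    finally show ?thesis .
  qed
  have "AE \<omega> in M. eventually (\<lambda>J. ?S r J \<omega> < (p + \<epsilon>) * J) sequentially" for r
  proof -
    have "AE \<omega> in M. eventually (\<lambda>J. \<omega> \<in> space M - ?B r J) sequentially"
    proof (rule borel_cantelli_AE1)
      show "?B r J \<in> events" for J by measurable
      show "emeasure M (?B r J) < \<infinity>" for J by (simp add: emeasure_eq_measure)
      have "summable (\<lambda>J. exp (- (2 * \<epsilon>\<^sup>2)) ^ J)"
        using \<open>\<epsilon> > 0\<close> by (intro summable_geometric) simp
      then show "summable (\<lambda>J. prob (?B r J))"
        by (rule summable_comparison_test_ev [rotated])
          (auto simp: eventually_sequentially B intro!: exI [of _ 1])
    qed
    then show ?thesis by eventually_elim (auto elim!: eventually_mono)
  qed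
  then have "AE \<omega> in M. \<forall>r. eventually (\<lambda>J. ?S r J \<omega> < (p + \<epsilon>) * J) sequentially"
    by (simp add: AE_all_countable)
  then show ?thesis
  proof eventually_elim
    case (elim \<omega>)
    then have "eventually (\<lambda>J. \<forall>r\<in>{..<L}. ?S r J \<omega> < (p + \<epsilon>) * J) sequentially"
      by (simp add: eventually_ball_finite)
    moreover have "filterlim (\<lambda>n. n div L + 1) sequentially sequentially"
    proof -
      have "filterlim (\<lambda>n. n div L) at_top at_top"
        unfolding filterlim_at_top
      proof
        fix Z
        show "eventually (\<lambda>n. Z \<le> n div L) at_top"
          using eventually_ge_at_top [of "Z * L"]
          by eventually_elim (use \<open>L > 0\<close> in \<open>simp add: less_eq_div_iff_mult_less_eq\<close>)
      qed
      then show ?thesis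
        by (rule filterlim_at_top_mono) auto
    qed
    ultimately have "eventually (\<lambda>n. \<forall>r\<in>{..<L}. ?S r (n div L + 1) \<omega> < (p + \<epsilon>) * (n div L + 1)) sequentially"
      by (rule eventually_compose_filterlim)
    then show ?case
    proof eventually_elim
      case (elim n)
      \<comment> \<open>Nonnegativity of \<open>p\<close> is what permits rounding \<open>n\<close>
        up to a multiple of \<open>L\<close>, at the cost of at most \<open>L\<close> extra
        terms.\<close>
      have "expectation (X 0) \<ge> 0" using X01 by (intro Bochner_Integration.integral_nonneg) auto
      with p [of 0] have "p \<ge> 0" by linarith
      let ?J = "n div L + 1"
      have n: "n \<le> ?J * L" "?J * L \<le> n + L"
        using \<open>L > 0\<close> dividend_less_times_div [of L n] by (auto simp: algebra_simps)
      have "(\<Sum>k<n. X k \<omega>) \<le> (\<Sum>k<?J * L. X k \<omega> :: real)"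
        using n X01 by (intro sum_mono2) auto
      also have "\<dots> = (\<Sum>j<?J. \<Sum>k\<in>{j * L..<j * L + L}. X k \<omega>)"
        by (rule sum.nat_group [symmetric])
      also have "\<dots> = (\<Sum>j<?J. \<Sum>r<L. X (r + j * L) \<omega>)"
      proof (rule sum.cong [OF refl])
        fix j
        show "(\<Sum>k\<in>{j * L..<j * L + L}. X k \<omega> :: real) = (\<Sum>r<L. X (r + j * L) \<omega>)"
          using sum.shift_bounds_nat_ivl [of "\<lambda>k. X k \<omega> :: real" 0 "j * L" L]
          by (simp add: add.commute lessThan_atLeast0)
      qed
      also have "\<dots> = (\<Sum>r<L. ?S r ?J \<omega>)" by (rule sum.swap)
      also have "\<dots> \<le> (\<Sum>r<L. (p + \<epsilon>) * ?J)"
        using elim by (intro sum_mono) (auto intro: less_imp_le)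
      also have "\<dots> = (p + \<epsilon>) * real (?J * L)" by (simp add: algebra_simps)
      also have "\<dots> \<le> (p + \<epsilon>) * real (n + L)"
        using \<open>p \<ge> 0\<close> \<open>\<epsilon> > 0\<close> by (intro mult_left_mono of_nat_mono n(2)) linarith
      finally show ?case .
    qed
  qed
qed

lemma (in prob_space) ex_prob_abs_gt_le:
  fixes X :: "'a \<Rightarrow> real"
  assumes [measurable]: "X \<in> borel_measurable M" and "\<epsilon> > 0"
  obtains K where "K > 0" "prob {\<omega>\<in>space M. \<bar>X \<omega>\<bar> > K} \<le> \<epsilon>"
proof -
  let ?A = "\<lambda>n::nat. {\<omega>\<in>space M. \<bar>X \<omega>\<bar> > real (Suc n)}"
  have "(\<lambda>n. prob (?A n)) \<longlonglongrightarrow> prob (\<Inter>n. ?A n)"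
    by (rule finite_Lim_measure_decseq) (auto simp: decseq_def)
  also have "(\<Inter>n. ?A n) = {}"
  proof safe
    fix \<omega> assume *: "\<omega> \<in> (\<Inter>n. ?A n)"
    obtain n :: nat where "\<bar>X \<omega>\<bar> < real n" using reals_Archimedean2 by blast
    moreover have "\<bar>X \<omega>\<bar> > real (Suc n)" using * by blast
    ultimately show "\<omega> \<in> {}" by simp
  qed
  finally have "(\<lambda>n. prob (?A n)) \<longlonglongrightarrow> 0" by simp
  then have "eventually (\<lambda>n. prob (?A n) < \<epsilon>) sequentially"
    using \<open>\<epsilon> > 0\<close> by (rule order_tendstoD)
  then obtain n where "prob (?A n) < \<epsilon>" by (auto simp: eventually_sequentially)
  then show thesis by (intro that [of "real (Suc n)"]) auto
qed

text \<open>If \<open>t\<close> exceeded \<open>a\<close> and \<open>b\<close> in absolute value,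
  both factors would have the sign of \<open>t\<close>. In the application \<open>t\<close> is the
  common part of two neighbouring window sums.\<close>

lemma mult_le_0_imp_small:
  fixes a b t K :: real
  assumes "(a + t) * (t + b) \<le> 0"
  shows "\<bar>t\<bar> \<le> K \<or> \<bar>a\<bar> > K \<or> \<bar>b\<bar> > K"
proof (rule ccontr)
  assume "\<not> ?thesis"
  then have "\<bar>t\<bar> > \<bar>a\<bar>" "\<bar>t\<bar> > \<bar>b\<bar>" by auto
  then have "(a + t > 0 \<and> t + b > 0) \<or> (a + t < 0 \<and> t + b < 0)" by linarith
  with assms show False by (auto simp: mult_le_0_iff)
qed

text \<open>A weak change requires a small common part or one of two large end terms, so it has
  probability at most \<open>3 * \<delta>\<close>; the fourth \<open>\<delta>\<close> is the slack
  in the almost sure bound.\<close>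

lemma (in prob_space) AE_eventually_window_changes_le:
  fixes \<eta> :: "nat \<Rightarrow> 'a \<Rightarrow> real" and s :: real
  assumes indep: "indep_vars (\<lambda>_. borel) \<eta> UNIV"
    and s: "s \<in> {1, -1}" and m: "m > 0" and \<delta>: "\<delta> > 0"
    and large: "\<And>k. prob {\<omega>\<in>space M. \<bar>\<eta> k \<omega>\<bar> > K} \<le> \<delta>"
    and small: "\<And>k. prob {\<omega>\<in>space M. \<bar>\<Sum>j\<in>{k+2..k+m}. s ^ j * \<eta> j \<omega>\<bar> \<le> K} \<le> \<delta>"
  defines "W \<equiv> \<lambda>\<omega> k. \<Sum>j\<in>{Suc k..k + m}. s ^ j * \<eta> j \<omega>"
  shows "AE \<omega> in M. eventually (\<lambda>n. card {k. k < n \<and> W \<omega> k * W \<omega> (Suc k) \<le> 0}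
    \<le> 4 * \<delta> * real (n + Suc m)) sequentially"
proof -
  have [measurable]: "\<eta> k \<in> borel_measurable M" for k
    using indep by (auto simp: indep_vars_def)
  have [measurable]: "(\<lambda>\<omega>. W \<omega> k) \<in> borel_measurable M" for k
    unfolding W_def by measurable
  define X :: "nat \<Rightarrow> 'a \<Rightarrow> real" where "X k \<omega> = of_bool (W \<omega> k * W \<omega> (Suc k) \<le> 0)" for k \<omega>
  \<comment> \<open>The pair of windows at \<open>k\<close> involves exactly these
    \<open>Suc m\<close> indices, so pairs \<open>Suc m\<close> apart use disjoint blocks.\<close>
  let ?K = "\<lambda>k. {Suc k..Suc k + m}"
  have "AE \<omega> in M. eventually (\<lambda>n. (\<Sum>k<n. X k \<omega>) \<le> (3 * \<delta> + \<delta>) * real (n + Suc m)) sequentially"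
  proof (rule AE_eventually_sum_le)
    fix r :: nat
    define Y :: "nat \<Rightarrow> (nat \<Rightarrow> real) \<Rightarrow> real" where
      "Y k f = of_bool ((\<Sum>j\<in>{Suc k..k + m}. s ^ j * f j) * (\<Sum>j\<in>{Suc (Suc k)..Suc k + m}. s ^ j * f j) \<le> 0)" for k f
    have "indep_vars (\<lambda>j. PiM (?K (r + j * Suc m)) (\<lambda>_. borel))
        (\<lambda>j \<omega>. restrict (\<lambda>i. \<eta> i \<omega>) (?K (r + j * Suc m))) UNIV"
    proof (rule indep_vars_restrict [OF indep])
      have "?K (r + i * Suc m) \<inter> ?K (r + j * Suc m) = {}" if "i < j" for i j
      proof -
        have "Suc i * Suc m \<le> j * Suc m" using that by (intro mult_le_mono1) simp
        then show ?thesis by auto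
      qed
      then show "disjoint_family_on (\<lambda>j. ?K (r + j * Suc m)) UNIV"
        unfolding disjoint_family_on_def by (metis Int_commute linorder_neqE_nat)
    qed simp
    then have "indep_vars (\<lambda>_. borel)
        (\<lambda>j \<omega>. Y (r + j * Suc m) (restrict (\<lambda>i. \<eta> i \<omega>) (?K (r + j * Suc m)))) UNIV"
    proof (rule indep_vars_compose2)
      fix j
      let ?k = "r + j * Suc m"
      have [measurable]: "(\<lambda>f. f i) \<in> borel_measurable (PiM (?K ?k) (\<lambda>_. borel))" if "i \<in> ?K ?k" for i
        using that by (rule measurable_component_singleton)
      have [measurable]: "(\<lambda>f. \<Sum>i\<in>I. s ^ i * f i) \<in> borel_measurable (PiM (?K ?k) (\<lambda>_. borel))"
        if "I \<subseteq> ?K ?k" for I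
        using that by (intro borel_measurable_sum borel_measurable_times borel_measurable_const) auto
      have "{Suc ?k..?k + m} \<subseteq> ?K ?k" "{Suc (Suc ?k)..Suc ?k + m} \<subseteq> ?K ?k" by auto
      then show "Y ?k \<in> borel_measurable (PiM (?K ?k) (\<lambda>_. borel))"
        unfolding Y_def by measurable
    qed
    also have "(\<lambda>j \<omega>. Y (r + j * Suc m) (restrict (\<lambda>i. \<eta> i \<omega>) (?K (r + j * Suc m)))) = (\<lambda>j. X (r + j * Suc m))"
      by (intro ext) (simp add: X_def Y_def W_def)
    finally show "indep_vars (\<lambda>_. borel) (\<lambda>j. X (r + j * Suc m)) UNIV" .
  next
    fix k
    let ?T = "{\<omega>\<in>space M. \<bar>\<Sum>j\<in>{k+2..k+m}. s ^ j * \<eta> j \<omega>\<bar> \<le> K}"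
    let ?L = "\<lambda>k. {\<omega>\<in>space M. \<bar>\<eta> k \<omega>\<bar> > K}"
    have "expectation (X k) = expectation (indicator {\<omega>\<in>space M. W \<omega> k * W \<omega> (Suc k) \<le> 0})"
      by (intro Bochner_Integration.integral_cong) (auto simp: X_def indicator_def)
    also have "\<dots> = prob {\<omega>\<in>space M. W \<omega> k * W \<omega> (Suc k) \<le> 0}" by simp
    also have "\<dots> \<le> prob (?T \<union> (?L (Suc k) \<union> ?L (Suc k + m)))"
    proof (rule finite_measure_mono)
      have s1: "\<bar>s ^ j\<bar> = 1" for j using s by (auto simp: power_abs)
      show "{\<omega>\<in>space M. W \<omega> k * W \<omega> (Suc k) \<le> 0} \<subseteq> ?T \<union> (?L (Suc k) \<union> ?L (Suc k + m))"
      proof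
        fix \<omega> assume \<omega>: "\<omega> \<in> {\<omega>\<in>space M. W \<omega> k * W \<omega> (Suc k) \<le> 0}"
        have "W \<omega> k = s ^ Suc k * \<eta> (Suc k) \<omega> + (\<Sum>j\<in>{k+2..k+m}. s ^ j * \<eta> j \<omega>)"
          unfolding W_def using m by (subst sum.atLeast_Suc_atMost) auto
        moreover have "W \<omega> (Suc k) = (\<Sum>j\<in>{k+2..k+m}. s ^ j * \<eta> j \<omega>) + s ^ (Suc k + m) * \<eta> (Suc k + m) \<omega>"
          unfolding W_def using m by (simp add: sum.nat_ivl_Suc')
        ultimately have "\<bar>\<Sum>j\<in>{k+2..k+m}. s ^ j * \<eta> j \<omega>\<bar> \<le> K
          \<or> \<bar>s ^ Suc k * \<eta> (Suc k) \<omega>\<bar> > K \<or> \<bar>s ^ (Suc k + m) * \<eta> (Suc k + m) \<omega>\<bar> > K"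
          using \<omega> by (intro mult_le_0_imp_small) simp
        then show "\<omega> \<in> ?T \<union> (?L (Suc k) \<union> ?L (Suc k + m))"
          using \<omega> unfolding abs_mult s1 by auto
      qed
    qed measurable
    also have "\<dots> \<le> prob ?T + (prob (?L (Suc k)) + prob (?L (Suc k + m)))"
      by (intro order_trans [OF measure_Un_le] add_left_mono) measurable
    also have "\<dots> \<le> \<delta> + (\<delta> + \<delta>)" by (intro add_mono small large)
    finally show "expectation (X k) \<le> 3 * \<delta>" by simp
  qed (use \<delta> in \<open>auto simp: X_def\<close>)
  moreover have "(\<Sum>k<n. X k \<omega>) = card {k. k < n \<and> W \<omega> k * W \<omega> (Suc k) \<le> 0}" for n \<omega>
  proof -
    have "{k. k < n \<and> W \<omega> k * W \<omega> (Suc k) \<le> 0} = {..<n} \<inter> {k. W \<omega> k * W \<omega> (Suc k) \<le> 0}" by auto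
    then show ?thesis by (simp add: X_def)
  qed
  ultimately show ?thesis by simp
qed

lemma (in prob_space) AE_eventually_num_real_roots_le:
  fixes \<eta> :: "nat \<Rightarrow> 'a \<Rightarrow> real"
  assumes indep: "indep_vars (\<lambda>_. borel) \<eta> UNIV"
    and ident: "\<And>k. distr M borel (\<eta> k) = distr M borel (\<eta> 0)"
    and nondeg: "\<And>c. \<not> (AE \<omega> in M. \<eta> 0 \<omega> = c)"
    and "\<epsilon> > 0"
  shows "AE \<omega> in M. eventually (\<lambda>n. real (num_real_roots \<eta> n \<omega>) / real n \<le> \<epsilon>) sequentially"
proof -
  have [measurable]: "\<eta> k \<in> borel_measurable M" for k
    using indep by (auto simp: indep_vars_def)
  \<comment> \<open>Each of the two signs contributes \<open>4 * \<delta>\<close>, together half of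
    \<open>\<epsilon>\<close>; the other half absorbs the terms of order
    \<open>m / n\<close>.\<close>
  define \<delta> where "\<delta> = \<epsilon> / 16"
  have \<delta>: "\<delta> > 0" using \<open>\<epsilon> > 0\<close> by (simp add: \<delta>_def)
  obtain K where K: "K > 0" "prob {\<omega>\<in>space M. \<bar>\<eta> 0 \<omega>\<bar> > K} \<le> \<delta>"
    using ex_prob_abs_gt_le [of "\<eta> 0" \<delta>] \<delta> by auto
  have large: "prob {\<omega>\<in>space M. \<bar>\<eta> k \<omega>\<bar> > K} \<le> \<delta>" for k
  proof -
    have *: "prob {\<omega>\<in>space M. \<bar>\<eta> k \<omega>\<bar> > K} = measure (distr M borel (\<eta> k)) {x. \<bar>x\<bar> > K}" for k
      by (subst measure_distr) (auto intro!: arg_cong [of _ _ prob])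
    show ?thesis using K(2) unfolding * ident [of k] .
  qed
  obtain m0 where m0: "\<forall>I s. finite I \<and> m0 \<le> card I \<and> (\<forall>k. s k \<in> {1, -1}) \<longrightarrow>
    prob {\<omega>\<in>space M. \<bar>\<Sum>k\<in>I. s k * \<eta> k \<omega>\<bar> \<le> K} \<le> \<delta>"
    using anticoncentration [OF indep ident nondeg K(1) \<delta>] by blast
  \<comment> \<open>The common part of two neighbouring windows has \<open>m - 1 = m0\<close>
    terms.\<close>
  define m where "m = Suc m0"
  define C where "C s n \<omega> = card {k. k < n \<and>
    (\<Sum>j\<in>{Suc k..k + m}. s ^ j * \<eta> j \<omega>) * (\<Sum>j\<in>{Suc (Suc k)..Suc k + m}. s ^ j * \<eta> j \<omega>) \<le> 0}"
    for s :: real and n \<omega>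
  have changes: "AE \<omega> in M. eventually (\<lambda>n. C s n \<omega> \<le> 4 * \<delta> * real (n + Suc m)) sequentially"
    if s: "s \<in> {1, -1}" for s
    unfolding C_def
  proof (rule AE_eventually_window_changes_le [OF indep s _ \<delta> large, where m = m])
    show "prob {\<omega>\<in>space M. \<bar>\<Sum>j\<in>{k+2..k+m}. s ^ j * \<eta> j \<omega>\<bar> \<le> K} \<le> \<delta>" for k
    proof (rule m0 [rule_format], intro conjI allI)
      show "s ^ j \<in> {1, -1}" for j using s by (cases "even j") auto
    qed (auto simp: m_def)
  qed (simp add: m_def)
  have "((\<lambda>n. 4 * real m / real n + 8 * \<delta> * (1 + real (Suc m) / real n)) \<longlongrightarrow> 0 + 8 * \<delta> * (1 + 0)) sequentially"
    by (intro tendsto_intros tendsto_divide_0 [OF tendsto_const] filterlim_at_top_imp_at_infinity filterlim_real_sequentially)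
  moreover have "0 + 8 * \<delta> * (1 + 0) < \<epsilon>" using \<open>\<epsilon> > 0\<close> by (simp add: \<delta>_def)
  ultimately have lim: "eventually (\<lambda>n. 4 * real m / real n + 8 * \<delta> * (1 + real (Suc m) / real n) < \<epsilon>) sequentially"
    by (rule order_tendstoD)
  from changes [OF insertI1] changes [OF insertI2 [OF singletonI]] show ?thesis
  proof eventually_elim
    case (elim \<omega>)
    from elim lim eventually_gt_at_top [of 0] show ?case
    proof eventually_elim
      case (elim n)
      have "num_real_roots \<eta> n \<omega> \<le> 4 * m + (\<Sum>s\<in>{1, -1}. C s n \<omega>)"
        unfolding C_def by (rule num_real_roots_le_window_changes) (simp add: m_def)
      also have "(\<Sum>s\<in>{1, -1}. C s n \<omega>) = C 1 n \<omega> + C (-1) n \<omega>" by simp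
      finally have "real (num_real_roots \<eta> n \<omega>) \<le> real (4 * m + (C 1 n \<omega> + C (-1) n \<omega>))"
        by (rule of_nat_mono)
      also have "\<dots> \<le> 4 * real m + (4 * \<delta> * real (n + Suc m) + 4 * \<delta> * real (n + Suc m))"
        using elim by simp
      finally have "real (num_real_roots \<eta> n \<omega>) \<le> 4 * real m + 8 * \<delta> * real (n + Suc m)" by simp
      then have "real (num_real_roots \<eta> n \<omega>) / real n \<le> (4 * real m + 8 * \<delta> * real (n + Suc m)) / real n"
        by (rule divide_right_mono) simp
      also have "\<dots> = 4 * real m / real n + 8 * \<delta> * (1 + real (Suc m) / real n)"
        using elim by (simp add: field_simps)
      finally show ?case using elim by linarith
    qed
  qed
qed

section \<open>Root counts of random polynomials\<close>

text \<open>The only real candidates are 1 and -1, and they are simple because the derivative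
  vanishes at neither.\<close>

lemma size_proots_unity_le:
  "size (proots (monom 1 (Suc n) - 1 :: real poly)) \<le> 2"
proof -
  let ?r = "monom 1 (Suc n) - 1 :: real poly"
  have "coeff ?r 0 = -1" by simp
  then have r: "?r \<noteq> 0" by (metis coeff_0 zero_neq_neg_one)
  have "proots ?r \<subseteq># mset_set {1, -1}"
  proof (rule mset_subset_eqI)
    fix x
    show "count (proots ?r) x \<le> count (mset_set {1, -1}) x"
    proof (cases "poly ?r x = 0")
      case True
      then have x: "x ^ Suc n = 1" by (simp add: poly_monom)
      then have "\<bar>x\<bar> ^ Suc n = 1 ^ Suc n" by (metis power_abs abs_one power_one)
      then have "\<bar>x\<bar> = 1" by (rule power_eq_imp_eq_base) auto
      then have x1: "x \<in> {1, -1}" by auto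
      have d: "pderiv ?r = monom (real (Suc n)) n"
        by (simp add: pderiv_diff pderiv_monom)
      have "order x ?r = Suc (order x (pderiv ?r))" using r True by (rule order_pderiv)
      moreover have "order x (pderiv ?r) = 0"
        unfolding d using x1 by (intro order_0I) (auto simp: poly_monom)
      ultimately have "order x ?r = 1" by simp
      then show ?thesis using r x1 by (auto simp: count_mset_set)
    next
      case False
      then show ?thesis using r by (simp add: order_0I)
    qed
  qed
  then have "size (proots ?r) \<le> size (mset_set {1, -1 :: real})" by (rule size_mset_mono)
  then show ?thesis by simp
qed

text \<open>Multiplying the geometric sum by \<open>x - 1\<close> gives
  \<open>c * (x^(n+1) - 1)\<close>.\<close>

lemma num_real_roots_const_le:
  assumes \<eta>: "\<And>k. \<eta> k \<omega> = c" and "c \<noteq> 0"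
  shows "num_real_roots \<eta> n \<omega> \<le> 2"
proof -
  define p where "p = random_poly \<eta> n \<omega>"
  have "coeff p 0 = c" by (simp add: p_def coeff_random_poly \<eta>)
  with \<open>c \<noteq> 0\<close> have "p \<noteq> 0" by auto
  have "[:-1, 1:] * p = smult c (monom 1 (Suc n) - 1)"
  proof (rule poly_eqI)
    fix k
    show "coeff ([:-1, 1:] * p) k = coeff (smult c (monom 1 (Suc n) - 1)) k"
      by (cases k) (auto simp: p_def coeff_random_poly \<eta> coeff_pCons split: nat.splits)
  qed
  then have "proots ([:-1, 1:] * p) = proots (monom 1 (Suc n) - 1)"
    using \<open>c \<noteq> 0\<close> by simp
  also have "proots ([:-1, 1:] * p) = add_mset 1 (proots p)"
    using \<open>p \<noteq> 0\<close> by (subst proots_mult) auto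
  finally have "size (add_mset 1 (proots p)) \<le> 2" using size_proots_unity_le [of n] by simp
  then show ?thesis by (simp add: num_real_roots_def p_def)
qed

text \<open>
  The almost surely constant case is separate because alternating sums of equal terms stay bounded.
\<close>

lemma (in prob_space) AE_num_real_roots_ratio_tendsto_0:
  fixes \<eta> :: "nat \<Rightarrow> 'a \<Rightarrow> real"
  assumes indep: "indep_vars (\<lambda>_. borel) \<eta> UNIV"
    and ident: "\<And>k. distr M borel (\<eta> k) = distr M borel (\<eta> 0)"
    and nz: "\<not> (AE \<omega> in M. \<eta> 0 \<omega> = 0)"
  shows "AE \<omega> in M. (\<lambda>n. real (num_real_roots \<eta> n \<omega>) / real n) \<longlonglongrightarrow> 0"
proof (cases "\<exists>c. AE \<omega> in M. \<eta> 0 \<omega> = c")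
  case True
  then obtain c where c: "AE \<omega> in M. \<eta> 0 \<omega> = c" by blast
  with nz have "c \<noteq> 0" by blast
  have [measurable]: "\<eta> k \<in> borel_measurable M" for k
    using indep by (auto simp: indep_vars_def)
  have "AE \<omega> in M. \<eta> k \<omega> = c" for k
  proof -
    have *: "(AE \<omega> in M. \<eta> k \<omega> = c) \<longleftrightarrow> (AE x in distr M borel (\<eta> k). x = c)" for k
      by (subst AE_distr_iff) auto
    show ?thesis using c unfolding * ident [of k] .
  qed
  then have "AE \<omega> in M. \<forall>k. \<eta> k \<omega> = c" by (simp add: AE_all_countable)
  then show ?thesis
  proof eventually_elim
    case (elim \<omega>)
    show ?case
    proof (rule tendsto_sandwich [of "\<lambda>_. 0" _ _ "\<lambda>n. 2 / real n"])
      show "\<forall>\<^sub>F n in sequentially. real (num_real_roots \<eta> n \<omega>) / real n \<le> 2 / real n"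
        using num_real_roots_const_le [of \<eta> \<omega> c] elim \<open>c \<noteq> 0\<close>
        by (intro always_eventually allI divide_right_mono) auto
      show "(\<lambda>n. 2 / real n) \<longlonglongrightarrow> 0" by (rule lim_const_over_n)
    qed auto
  qed
next
  case False
  \<comment> \<open>Countably many thresholds suffice, so the exceptional null sets can be
    united.\<close>
  have "AE \<omega> in M. \<forall>i. eventually (\<lambda>n. real (num_real_roots \<eta> n \<omega>) / real n \<le> 1 / real (Suc i)) sequentially"
    unfolding AE_all_countable
    by (intro allI AE_eventually_num_real_roots_le [OF indep ident]) (use False in auto)
  then show ?thesis
  proof eventually_elim
    case (elim \<omega>)
    show ?case
    proof (rule order_tendstoI)
      fix a :: real assume "0 < a"
      then obtain i where "1 / real (Suc i) < a" using nat_approx_posE by blast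
      with elim [rule_format, of i]
      show "\<forall>\<^sub>F n in sequentially. real (num_real_roots \<eta> n \<omega>) / real n < a"
        by (auto elim!: eventually_mono)
    next
      fix a :: real assume "a < 0"
      then show "\<forall>\<^sub>F n in sequentially. a < real (num_real_roots \<eta> n \<omega>) / real n"
        by (intro always_eventually allI) (meson divide_nonneg_nonneg less_le_trans of_nat_0_le_iff)
    qed
  qed
qed

lemma num_real_roots_le: "num_real_roots \<eta> n \<omega> \<le> n"
  unfolding num_real_roots_def using size_proots_le degree_random_poly_le by (rule order_trans)

theorem theorem4:
  fixes P :: "'a measure" and \<eta> :: "nat \<Rightarrow> 'a \<Rightarrow> real"
  assumes "prob_space P"
    and "prob_space.indep_vars P (\<lambda>_. borel) \<eta> UNIV"
    and "\<And>k. distr P borel (\<eta> k) = distr P borel (\<eta> 0)"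
    and "measure P {\<omega> \<in> space P. \<eta> 0 \<omega> = 0} < 1"
  shows "measure P {\<omega> \<in> space P.
            (\<lambda>n. real (num_real_roots \<eta> n \<omega>) / real n) \<longlonglongrightarrow> 0} = 1
       \<and> (\<forall>n. integrable P (\<lambda>\<omega>. real (num_real_roots \<eta> n \<omega>)))
       \<and> (\<lambda>n. \<integral>\<omega>. real (num_real_roots \<eta> n \<omega>) \<partial>P) \<in> o(\<lambda>n. real n)"
proof (intro conjI allI)
  interpret prob_space P by fact
  have [measurable]: "\<eta> k \<in> borel_measurable P" for k
    using assms(2) by (auto simp: indep_vars_def)
  have [measurable]: "(\<lambda>\<omega>. real (num_real_roots \<eta> n \<omega>)) \<in> borel_measurable P" for n
    by (rule measurable_compose [OF measurable_num_real_roots]) auto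
  have "\<not> (AE \<omega> in P. \<eta> 0 \<omega> = 0)"
    using assms(4) prob_Collect_eq_1 [of "\<lambda>\<omega>. \<eta> 0 \<omega> = 0"] by auto
  with assms have lim: "AE \<omega> in P. (\<lambda>n. real (num_real_roots \<eta> n \<omega>) / real n) \<longlonglongrightarrow> 0"
    by (intro AE_num_real_roots_ratio_tendsto_0) auto
  then show "measure P {\<omega> \<in> space P. (\<lambda>n. real (num_real_roots \<eta> n \<omega>) / real n) \<longlonglongrightarrow> 0} = 1"
    by (subst prob_Collect_eq_1) auto
  show "integrable P (\<lambda>\<omega>. real (num_real_roots \<eta> n \<omega>))" for n
    by (rule integrable_const_bound [where B = "real n"]) (auto simp: num_real_roots_le)
  have "(\<lambda>n. \<integral>\<omega>. real (num_real_roots \<eta> n \<omega>) / real n \<partial>P) \<longlonglongrightarrow> (\<integral>\<omega>. 0 \<partial>P)"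
  proof (rule integral_dominated_convergence [where w = "\<lambda>_. 1"])
    \<comment> \<open>For \<open>n = 0\<close> the quotient is 0, as division by zero yields
      0.\<close>
    show "AE \<omega> in P. norm (real (num_real_roots \<eta> n \<omega>) / real n) \<le> 1" for n
      using num_real_roots_le [of \<eta> n] by (intro AE_I2) (auto simp: divide_le_eq_1)
  qed (use lim in auto)
  then show "(\<lambda>n. \<integral>\<omega>. real (num_real_roots \<eta> n \<omega>) \<partial>P) \<in> o(\<lambda>n. real n)"
    by (intro smalloI_tendsto) (auto simp: eventually_sequentially intro!: exI [of _ 1])
qed

end
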